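(* Let $F$ be a field, and let $(H_n)_{n\ge 0}$ and $(K_n)_{n\ge 0}$ be sequences in $F$ with $H_0=K_0=1$ and $H_nK_n\neq 0$ for all $n\ge 1$. Then there is a unique nondegenerate Stieltjes fraction $$\cfrac{c_0}{1-\cfrac{c_1x}{1-\cfrac{c_2x}{1-\cfrac{c_3x}{\ddots}}}}=\sum_{n\ge 0}g_nx^n\in F[[x]]$$ such that for all $n\ge 1$ $$\det(g_{i+j})_{0\le i,j\le n-1}=H_n\qquad\text{and}\qquad \det(g_{i+j+1})_{0\le i,j\le n-1}=K_n.$$ Its coefficients are $$c_0=H_1,\qquad c_{2n-1}=\frac{H_{n-1}K_n}{H_nK_{n-1}},\qquad c_{2n}=\frac{H_{n+1}K_{n-1}}{H_nK_n}\qquad(n\ge 1).$$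
   Context: A Stieltjes fraction with coefficients $(c_j)_{j\ge 0}$ in $F$ is the displayed infinite continued fraction, understood as a formal power series, i.e. as the $x$-adic limit of its finite truncations. It is called nondegenerate if $c_j\neq 0$ for all $j\ge 0$. *)

theory Defs
  imports "HOL-Computational_Algebra.Formal_Power_Series" "Jordan_Normal_Form.Determinant"
begin

text \<open>The truncation after \<open>c n\<close>, i.e.
  \<open>c 0 / (1 - c 1 x / (1 - c 2 x / (... / (1 - c n x))))\<close>.
  All denominators have constant term 1, so the divisions are by units.\<close>

fun stieltjes_trunc :: "(nat \<Rightarrow> 'a::field) \<Rightarrow> nat \<Rightarrow> 'a fps" where
  "stieltjes_trunc c 0 = fps_const (c 0)"
| "stieltjes_trunc c (Suc n) =
     fps_const (c 0) / (1 - fps_X * stieltjes_trunc (\<lambda>j. c (Suc j)) n)"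

text \<open>The limit is taken in the library's metric on \<^typ>\<open>'a fps\<close>, which induces the
  \<open>x\<close>-adic topology.\<close>

definition stieltjes_fraction :: "(nat \<Rightarrow> 'a::field) \<Rightarrow> 'a fps \<Rightarrow> bool" where
  "stieltjes_fraction c g \<longleftrightarrow> stieltjes_trunc c \<longlonglongrightarrow> g"

definition nondegenerate :: "(nat \<Rightarrow> 'a::field) \<Rightarrow> bool" where
  "nondegenerate c \<longleftrightarrow> (\<forall>j. c j \<noteq> 0)"

definition hankel_mat :: "nat \<Rightarrow> 'a fps \<Rightarrow> nat \<Rightarrow> 'a mat" where
  "hankel_mat s g n = mat n n (\<lambda>(i, j). fps_nth g (i + j + s))"

end

theory Submission
  imports Defs
begin

text \<open>
  Removing the top layer of a Stieltjes fraction \<open>g\<close> leaves the fraction \<open>h\<close> with shifted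
  coefficients, and \<open>g = c 0 + x h g\<close>. Write \<open>T u\<close> for the lower triangular Toeplitz matrix of a
  series \<open>u\<close>. Since \<open>(1 - x h) g\<close> is constant, each entry of \<open>T (1 - x h)\<close> times a Hankel matrix of
  \<open>g\<close> is one part of a convolution sum of positive degree, which vanishes (only the corner
  entry in the unshifted case has degree zero). So it equals minus the remaining part, and that is an entry of a Hankel matrix of \<open>h\<close> times the transpose of \<open>T g\<close>. The triangular factors have
  determinants \<open>1\<close> and \<open>c 0 ^ n\<close>, which gives \<open>det_hankel_1\<close> and \<open>det_hankel_0\<close>: one step down
  the fraction turns shifted Hankel determinants into unshifted ones of the same size, and unshifted
  ones into shifted ones of size smaller by one.

  Let \<open>hankel_det g\<close> be the sequence of unshifted and shifted determinants of sizes
  \<open>0, 0, 1, 1, 2, 2, ...\<close> in alternation. For it both facts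
  say that index \<open>m + 1\<close> for \<open>g\<close> reduces to index \<open>m\<close> for \<open>h\<close>, up to a power of \<open>c 0\<close>. Induction
  then yields the single recurrence \<open>stieltjes_coeff_hankel_det\<close>, which expresses each
  \<open>c (m + 1)\<close> by four consecutive terms of this sequence. As the prescribed determinants do not
  vanish, the recurrence can be solved both for the coefficient and for the last determinant:
  the determinants are the prescribed ones if and only if the coefficients are given by the
  formula (\<open>hankel_det_eq_iff\<close>). Since every coefficient sequence has exactly one limit series,
  existence, uniqueness and the formulas follow together.
\<close>

section \<open>Convergence and the functional equation\<close>

lemma functional_eq_nth_Suc:
  fixes F U :: "'a::field fps"
  assumes "F = fps_const a + fps_X * U * F"
  shows "fps_nth F (Suc k) = (\<Sum>i=0..k. fps_nth U i * fps_nth F (k - i))"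
proof -
  have "fps_nth F (Suc k) = fps_nth (fps_const a + fps_X * (U * F)) (Suc k)"
    using assms by (simp add: mult.assoc)
  also have "\<dots> = fps_nth (U * F) k"
    by simp
  finally show ?thesis
    by (simp add: fps_mult_nth)
qed

lemma functional_eq_nth_0:
  fixes F U :: "'a::field fps"
  assumes "F = fps_const a + fps_X * U * F"
  shows "fps_nth F 0 = a"
  by (subst assms) simp

text \<open>The factor \<open>x\<close> delays the influence of \<open>U\<close> by one degree: agreement of \<open>U\<close> and \<open>V\<close> below
  degree \<open>n\<close> propagates to agreement of \<open>F\<close> and \<open>G\<close> up to and including degree \<open>n\<close>. This gain of
  one degree per layer is what makes the truncations converge.\<close>

lemma functional_eq_nth_cong:
  fixes F G U V :: "'a::field fps"
  assumes F: "F = fps_const a + fps_X * U * F" and G: "G = fps_const a + fps_X * V * G"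
    and agree: "\<And>j. j < n \<Longrightarrow> fps_nth U j = fps_nth V j"
  shows "k \<le> n \<Longrightarrow> fps_nth F k = fps_nth G k"
proof (induction k rule: less_induct)
  case (less k)
  show ?case
  proof (cases k)
    case 0
    then show ?thesis
      using functional_eq_nth_0[OF F] functional_eq_nth_0[OF G] by simp
  next
    case (Suc m)
    then show ?thesis
      unfolding Suc functional_eq_nth_Suc[OF F] functional_eq_nth_Suc[OF G]
      using less agree Suc by (intro sum.cong arg_cong2[where f = "(*)"]) auto
  qed
qed

lemma stieltjes_trunc_Suc_eq:
  "stieltjes_trunc c (Suc n) = fps_const (c 0)
     + fps_X * stieltjes_trunc (\<lambda>j. c (Suc j)) n * stieltjes_trunc c (Suc n)"
proof -
  let ?d = "1 - fps_X * stieltjes_trunc (\<lambda>j. c (Suc j)) n"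
  have "fps_nth ?d 0 \<noteq> 0"
    by simp
  then have "stieltjes_trunc c (Suc n) * ?d = fps_const (c 0)"
    by (simp add: fps_divide_unit mult.assoc inverse_mult_eq_1 del: fps_mult_nth_0)
  then show ?thesis
    by (simp add: algebra_simps del: stieltjes_trunc.simps)
qed

lemma stieltjes_trunc_nth_Suc:
  "k \<le> n \<Longrightarrow> fps_nth (stieltjes_trunc c (Suc n)) k = fps_nth (stieltjes_trunc c n) k"
proof (induction n arbitrary: c k)
  case 0
  then show ?case
    using functional_eq_nth_0[OF stieltjes_trunc_Suc_eq[of c 0]] by simp
next
  case (Suc n)
  show ?case
    by (rule functional_eq_nth_cong[OF stieltjes_trunc_Suc_eq stieltjes_trunc_Suc_eq _ Suc.prems])
       (simp add: Suc.IH del: stieltjes_trunc.simps)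
qed

lemma ex_stieltjes_fraction: "\<exists>g. stieltjes_fraction c g"
proof -
  have "fps_nth (stieltjes_trunc c n) k = fps_nth (stieltjes_trunc c k) k" if "k \<le> n" for k n
    using that
    by (induction n rule: dec_induct) (simp_all add: stieltjes_trunc_nth_Suc del: stieltjes_trunc.simps)
  then have "stieltjes_fraction c (Abs_fps (\<lambda>k. fps_nth (stieltjes_trunc c k) k))"
    unfolding stieltjes_fraction_def tendsto_fps_iff eventually_sequentially fps_nth_Abs_fps
    by blast
  then show ?thesis ..
qed

lemma stieltjes_fraction_unique:
  "stieltjes_fraction c g \<Longrightarrow> stieltjes_fraction c g' \<Longrightarrow> g = g'"
  unfolding stieltjes_fraction_def by (rule LIMSEQ_unique)

text \<open>The equation holds for truncations, and in each degree it involves only finitely many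
  coefficients, which are eventually those of the limits.\<close>

lemma stieltjes_fraction_functional_eq:
  assumes g: "stieltjes_fraction c g" and h: "stieltjes_fraction (\<lambda>j. c (Suc j)) h"
  shows "g = fps_const (c 0) + fps_X * h * g"
proof (rule fps_ext)
  fix k
  let ?T = "\<lambda>n. stieltjes_trunc c (Suc n)" and ?U = "stieltjes_trunc (\<lambda>j. c (Suc j))"
  have "eventually (\<lambda>n. \<forall>j\<le>k. fps_nth (?T n) j = fps_nth g j) sequentially"
    using eventually_fps_nth_eq_nhds_fps_strong LIMSEQ_Suc[OF g[unfolded stieltjes_fraction_def]]
    by (rule eventually_compose_filterlim)
  moreover have "eventually (\<lambda>n. \<forall>j\<le>k. fps_nth (?U n) j = fps_nth h j) sequentially"
    using eventually_fps_nth_eq_nhds_fps_strong h[unfolded stieltjes_fraction_def]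
    by (rule eventually_compose_filterlim)
  ultimately have "eventually (\<lambda>n. (\<forall>j\<le>k. fps_nth (?T n) j = fps_nth g j) \<and>
      (\<forall>j\<le>k. fps_nth (?U n) j = fps_nth h j)) sequentially"
    by (rule eventually_conj)
  then obtain n where T: "\<And>j. j \<le> k \<Longrightarrow> fps_nth (?T n) j = fps_nth g j"
    and U: "\<And>j. j \<le> k \<Longrightarrow> fps_nth (?U n) j = fps_nth h j"
    by (auto simp: eventually_sequentially simp del: stieltjes_trunc.simps)
  show "fps_nth g k = fps_nth (fps_const (c 0) + fps_X * h * g) k"
  proof (cases k)
    case 0
    then show ?thesis
      using T[of 0] functional_eq_nth_0[OF stieltjes_trunc_Suc_eq[of c n]] by simp
  next
    case (Suc m)
    have "fps_nth g k = fps_nth (?T n) (Suc m)"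
      using T[of k] Suc by simp
    also have "\<dots> = (\<Sum>i=0..m. fps_nth h i * fps_nth g (m - i))"
      unfolding functional_eq_nth_Suc[OF stieltjes_trunc_Suc_eq]
      using Suc by (intro sum.cong) (simp_all add: T U del: stieltjes_trunc.simps)
    also have "\<dots> = fps_nth (h * g) m"
      by (simp add: fps_mult_nth)
    also have "\<dots> = fps_nth (fps_const (c 0) + fps_X * (h * g)) k"
      using Suc by simp
    finally show ?thesis
      by (simp add: mult.assoc)
  qed
qed

section \<open>Hankel determinants under one step of the continued fraction\<close>

definition toeplitz_mat :: "'a::field fps \<Rightarrow> nat \<Rightarrow> 'a mat" where
  "toeplitz_mat g n = mat n n (\<lambda>(i, j). if j \<le> i then fps_nth g (i - j) else 0)"

lemma toeplitz_mat_carrier [simp]: "toeplitz_mat g n \<in> carrier_mat n n"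
  by (simp add: toeplitz_mat_def)

lemma hankel_mat_carrier [simp]: "hankel_mat s g n \<in> carrier_mat n n"
  by (simp add: hankel_mat_def)

lemma det_toeplitz_mat: "det (toeplitz_mat g n) = fps_nth g 0 ^ n"
proof -
  have "det (toeplitz_mat g n) = prod_list (diag_mat (toeplitz_mat g n))"
    by (rule det_lower_triangular[of n]) (auto simp: toeplitz_mat_def)
  also have "\<dots> = fps_nth g 0 ^ n"
    by (simp add: prod_list_diag_prod toeplitz_mat_def)
  finally show ?thesis .
qed

lemma toeplitz_mult_nth:
  assumes "A \<in> carrier_mat n n" "i < n" "j < n"
  shows "(toeplitz_mat u n * A) $$ (i, j) = (\<Sum>a\<le>i. fps_nth u (i - a) * A $$ (a, j))"
proof -
  have "(toeplitz_mat u n * A) $$ (i, j)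
      = (\<Sum>a\<in>{0..<n}. (if a \<le> i then fps_nth u (i - a) else 0) * A $$ (a, j))"
    using assms by (simp add: toeplitz_mat_def scalar_prod_def)
  also have "\<dots> = (\<Sum>a\<le>i. fps_nth u (i - a) * A $$ (a, j))"
    using assms by (intro sum.mono_neutral_cong_right) auto
  finally show ?thesis .
qed

lemma mult_toeplitz_transpose_nth:
  assumes "A \<in> carrier_mat n n" "i < n" "j < n"
  shows "(A * transpose_mat (toeplitz_mat g n)) $$ (i, j)
      = (\<Sum>b\<le>j. A $$ (i, b) * fps_nth g (j - b))"
proof -
  have "(A * transpose_mat (toeplitz_mat g n)) $$ (i, j)
      = (\<Sum>b\<in>{0..<n}. A $$ (i, b) * (if b \<le> j then fps_nth g (j - b) else 0))"
    using assms by (simp add: toeplitz_mat_def scalar_prod_def)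
  also have "\<dots> = (\<Sum>b\<le>j. A $$ (i, b) * fps_nth g (j - b))"
    using assms by (intro sum.mono_neutral_cong_right) auto
  finally show ?thesis .
qed

text \<open>With \<open>u = 1 - x h\<close>, the coefficient of \<open>u g = a\<close> in the positive degree \<open>i + s\<close> is zero. Its
  convolution sum splits at \<open>s\<close>; on the lower part every index of \<open>u\<close> is positive, where
  \<open>u\<close> is \<open>- x h\<close>.\<close>

lemma convolution_tail:
  fixes g h :: "'a::field fps"
  assumes g: "g = fps_const a + fps_X * h * g" and pos: "0 < i + s"
  shows "(\<Sum>k\<le>i. fps_nth (1 - fps_X * h) (i - k) * fps_nth g (k + s))
       = (\<Sum>b<s. fps_nth h (i + b) * fps_nth g (s - Suc b))"
proof -
  let ?u = "1 - fps_X * h"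
  have "?u * g = fps_const a"
    using g by (simp add: algebra_simps)
  then have "0 = fps_nth (g * ?u) (i + s)"
    using pos by (auto simp: mult.commute[of g])
  also have "\<dots> = (\<Sum>k\<in>{..<s} \<union> {s..i + s}. fps_nth g k * fps_nth ?u (i + s - k))"
    unfolding fps_mult_nth by (intro sum.cong) auto
  also have "\<dots> = (\<Sum>k<s. fps_nth g k * fps_nth ?u (i + s - k))
      + (\<Sum>k\<in>{s..i + s}. fps_nth g k * fps_nth ?u (i + s - k))"
    by (rule sum.union_disjoint) auto
  also have "(\<Sum>k<s. fps_nth g k * fps_nth ?u (i + s - k))
      = (\<Sum>b<s. fps_nth g (s - Suc b) * fps_nth ?u (i + s - (s - Suc b)))"
    by (rule sum.nat_diff_reindex[symmetric])
  also have "\<dots> = (\<Sum>b<s. - (fps_nth h (i + b) * fps_nth g (s - Suc b)))"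
  proof (rule sum.cong)
    fix b assume "b \<in> {..<s}"
    then have "i + s - (s - Suc b) = Suc (i + b)"
      by auto
    then show "fps_nth g (s - Suc b) * fps_nth ?u (i + s - (s - Suc b))
        = - (fps_nth h (i + b) * fps_nth g (s - Suc b))"
      by simp
  qed simp
  also have "(\<Sum>k\<in>{s..i + s}. fps_nth g k * fps_nth ?u (i + s - k))
      = (\<Sum>k\<le>i. fps_nth ?u (i - k) * fps_nth g (k + s))"
    by (rule sum.reindex_bij_witness[of _ "\<lambda>k. k + s" "\<lambda>k. k - s"]) auto
  finally show ?thesis
    by (simp add: sum_negf)
qed

lemma det_eq_if_toeplitz_intertwine:
  fixes g h :: "'a::field fps"
  assumes A: "A \<in> carrier_mat n n" and B: "B \<in> carrier_mat n n"
    and eq: "toeplitz_mat (1 - fps_X * h) n * A = B * transpose_mat (toeplitz_mat g n)"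
  shows "det A = fps_nth g 0 ^ n * det B"
proof -
  have "det (toeplitz_mat (1 - fps_X * h) n) * det A = det B * det (transpose_mat (toeplitz_mat g n))"
    using arg_cong[OF eq, of det] A B by (simp add: det_mult[where n = n])
  then show ?thesis
    by (simp add: det_toeplitz_mat det_transpose[where n = n] mult.commute)
qed

lemma det_hankel_1:
  fixes g h :: "'a::field fps"
  assumes g: "g = fps_const a + fps_X * h * g"
  shows "det (hankel_mat 1 g n) = a ^ n * det (hankel_mat 0 h n)"
proof -
  have "toeplitz_mat (1 - fps_X * h) n * hankel_mat 1 g n
      = hankel_mat 0 h n * transpose_mat (toeplitz_mat g n)" (is "?L = ?R")
  proof (rule eq_matI)
    fix i j assume "i < dim_row ?R" "j < dim_col ?R"
    then have ij: "i < n" "j < n"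
      by (simp_all add: hankel_mat_def toeplitz_mat_def)
    have "?L $$ (i, j) = (\<Sum>k\<le>i. fps_nth (1 - fps_X * h) (i - k) * fps_nth g (k + Suc j))"
      unfolding toeplitz_mult_nth[OF hankel_mat_carrier ij]
      using ij by (intro sum.cong) (simp_all add: hankel_mat_def)
    also have "\<dots> = (\<Sum>b<Suc j. fps_nth h (i + b) * fps_nth g (Suc j - Suc b))"
      by (rule convolution_tail[OF g]) simp
    also have "\<dots> = ?R $$ (i, j)"
      unfolding mult_toeplitz_transpose_nth[OF hankel_mat_carrier ij] lessThan_Suc_atMost
      using ij by (intro sum.cong) (simp_all add: hankel_mat_def)
    finally show "?L $$ (i, j) = ?R $$ (i, j)" .
  qed (simp_all add: hankel_mat_def toeplitz_mat_def)
  then have "det (hankel_mat 1 g n) = fps_nth g 0 ^ n * det (hankel_mat 0 h n)"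
    by (rule det_eq_if_toeplitz_intertwine[rotated 2]) simp_all
  then show ?thesis
    by (simp only: functional_eq_nth_0[OF g])
qed

text \<open>The argument is that of the shifted case, except that in row \<open>0\<close>, column \<open>0\<close> the convolution
  has degree zero and does not vanish. This is why a block \<open>1\<close> splits off and the Hankel matrix of
  \<open>h\<close> is smaller by one.\<close>

lemma det_hankel_0:
  fixes g h :: "'a::field fps"
  assumes g: "g = fps_const a + fps_X * h * g"
  shows "det (hankel_mat 0 g (Suc n)) = a ^ Suc n * det (hankel_mat 1 h n)"
proof -
  define M where "M = four_block_mat (1\<^sub>m 1) (0\<^sub>m 1 n) (0\<^sub>m n 1) (hankel_mat 1 h n)"
  have M: "M \<in> carrier_mat (Suc n) (Suc n)"
    unfolding M_def by (auto simp: hankel_mat_def)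
  have M_nth: "M $$ (i, j) = (if i = 0 \<or> j = 0 then of_bool (i = j) else fps_nth h (i + j - 1))"
    if "i < Suc n" "j < Suc n" for i j
    using that by (auto simp: M_def hankel_mat_def)
  have "toeplitz_mat (1 - fps_X * h) (Suc n) * hankel_mat 0 g (Suc n)
      = M * transpose_mat (toeplitz_mat g (Suc n))" (is "?L = ?R")
  proof (rule eq_matI)
    fix i j assume "i < dim_row ?R" "j < dim_col ?R"
    then have ij: "i < Suc n" "j < Suc n"
      using M by (simp_all add: toeplitz_mat_def)
    have L: "?L $$ (i, j) = (\<Sum>k\<le>i. fps_nth (1 - fps_X * h) (i - k) * fps_nth g (k + j))"
      unfolding toeplitz_mult_nth[OF hankel_mat_carrier ij]
      using ij by (intro sum.cong) (simp_all add: hankel_mat_def)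
    have R: "?R $$ (i, j) = M $$ (i, 0) * fps_nth g j
        + (\<Sum>b<j. M $$ (i, Suc b) * fps_nth g (j - Suc b))"
      unfolding mult_toeplitz_transpose_nth[OF M ij] sum.atMost_shift by simp
    show "?L $$ (i, j) = ?R $$ (i, j)"
    proof (cases i)
      case 0
      have "(\<Sum>b<j. M $$ (i, Suc b) * fps_nth g (j - Suc b)) = 0"
        using ij 0 by (intro sum.neutral) (simp add: M_nth)
      then show ?thesis
        unfolding L R using 0 by (simp add: M_nth)
    next
      case (Suc l)
      have "?L $$ (i, j) = (\<Sum>b<j. fps_nth h (i + b) * fps_nth g (j - Suc b))"
        unfolding L using Suc by (intro convolution_tail[OF g]) simp
      also have "\<dots> = (\<Sum>b<j. M $$ (i, Suc b) * fps_nth g (j - Suc b))"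
        using ij Suc by (intro sum.cong) (simp_all add: M_nth)
      also have "\<dots> = ?R $$ (i, j)"
        unfolding R using Suc ij by (simp add: M_nth)
      finally show ?thesis .
    qed
  qed (use M in \<open>simp_all add: hankel_mat_def toeplitz_mat_def\<close>)
  then have "det (hankel_mat 0 g (Suc n)) = fps_nth g 0 ^ Suc n * det M"
    by (rule det_eq_if_toeplitz_intertwine[rotated 2]) (simp_all add: M)
  also have "det M = det (hankel_mat 1 h n)"
    unfolding M_def by (subst det_four_block_mat_lower_left_zero[where n = 1 and m = n]) auto
  finally show ?thesis
    by (simp only: functional_eq_nth_0[OF g])
qed

section \<open>The recurrence for the interleaved determinants\<close>

text \<open>Unshifted and shifted determinants alternate, so that the odd and even coefficients of the
  fraction obey one and the same recurrence.\<close>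

definition hankel_det :: "'a::field fps \<Rightarrow> nat \<Rightarrow> 'a" where
  "hankel_det g m = det (hankel_mat (m mod 2) g (m div 2))"

lemma hankel_det_even: "hankel_det g (2 * n) = det (hankel_mat 0 g n)"
  and hankel_det_odd: "hankel_det g (Suc (2 * n)) = det (hankel_mat 1 g n)"
  by (simp_all add: hankel_det_def)

lemma hankel_det_start: "hankel_det g 0 = 1" "hankel_det g (Suc 0) = 1"
  by (simp_all add: hankel_det_def)

lemma hankel_det_Suc:
  assumes g: "g = fps_const a + fps_X * h * g"
  shows "hankel_det g (Suc m) = a ^ (Suc m div 2) * hankel_det h m"
proof (cases "even m")
  case True
  then obtain n where "m = 2 * n" by blast
  then show ?thesis
    using det_hankel_1[OF g] by (simp only: hankel_det_even hankel_det_odd) simp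
next
  case False
  then obtain n where n: "m = Suc (2 * n)" by (auto elim: oddE)
  have "hankel_det g (Suc m) = det (hankel_mat 0 g (Suc n))"
    using hankel_det_even[of g "Suc n"] n by simp
  then show ?thesis
    using det_hankel_0[OF g, of n] n by (simp only: hankel_det_odd) simp
qed

lemma hankel_det_2:
  assumes "stieltjes_fraction c g"
  shows "hankel_det g (Suc (Suc 0)) = c 0"
proof -
  obtain h where h: "stieltjes_fraction (\<lambda>j. c (Suc j)) h"
    using ex_stieltjes_fraction ..
  show ?thesis
    unfolding hankel_det_Suc[OF stieltjes_fraction_functional_eq[OF assms h]]
    by (simp add: hankel_det_start)
qed

text \<open>Passing to the shifted fraction lowers all four determinant indices and the index of \<open>c\<close> by
  one; the powers of \<open>c 0\<close> that appear on the two sides have the same total exponent \<open>m + 1\<close>.\<close>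

lemma stieltjes_coeff_hankel_det:
  assumes "stieltjes_fraction c g"
  shows "c (Suc m) * (hankel_det g (Suc (Suc m)) * hankel_det g (Suc m))
       = hankel_det g (Suc (Suc (Suc m))) * hankel_det g m"
  using assms
proof (induction m arbitrary: c g)
  case (0 c g)
  obtain h where h: "stieltjes_fraction (\<lambda>j. c (Suc j)) h"
    using ex_stieltjes_fraction ..
  have "Suc (Suc (Suc 0)) div 2 = 1"
    by simp
  then have "hankel_det g (Suc (Suc (Suc 0))) = c 0 * c (Suc 0)"
    by (simp only: hankel_det_Suc[OF stieltjes_fraction_functional_eq[OF 0 h]]
        hankel_det_2[OF h] power_one_right)
  then show ?case
    by (simp add: hankel_det_2[OF 0] hankel_det_start)
next
  case (Suc m c g)
  obtain h where h: "stieltjes_fraction (\<lambda>j. c (Suc j)) h"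
    using ex_stieltjes_fraction ..
  note E = hankel_det_Suc[OF stieltjes_fraction_functional_eq[OF Suc.prems h]]
  have exps: "Suc (Suc (Suc m)) div 2 + Suc (Suc m) div 2
      = Suc (Suc (Suc (Suc m))) div 2 + Suc m div 2"
    by simp
  have "c (Suc (Suc m)) * (hankel_det g (Suc (Suc (Suc m))) * hankel_det g (Suc (Suc m)))
     = c 0 ^ (Suc (Suc (Suc m)) div 2 + Suc (Suc m) div 2)
        * (c (Suc (Suc m)) * (hankel_det h (Suc (Suc m)) * hankel_det h (Suc m)))"
    by (simp only: E power_add mult_ac)
  also have "\<dots> = c 0 ^ (Suc (Suc (Suc (Suc m))) div 2 + Suc m div 2)
        * (hankel_det h (Suc (Suc (Suc m))) * hankel_det h m)"
    unfolding Suc.IH[OF h] exps ..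
  also have "\<dots> = hankel_det g (Suc (Suc (Suc (Suc m)))) * hankel_det g (Suc m)"
    by (simp only: E power_add mult_ac)
  finally show ?case .
qed

text \<open>From left to right the recurrence is solved for the coefficient, from right to left for the
  determinant of largest index.\<close>

lemma hankel_det_eq_iff:
  fixes E :: "nat \<Rightarrow> 'a::field"
  assumes g: "stieltjes_fraction c g" and E0: "E 0 = 1" "E (Suc 0) = 1" and nz: "\<And>m. E m \<noteq> 0"
  shows "(\<forall>m. hankel_det g m = E m) \<longleftrightarrow> c 0 = E (Suc (Suc 0)) \<and>
    (\<forall>m. c (Suc m) = E (Suc (Suc (Suc m))) * E m / (E (Suc (Suc m)) * E (Suc m)))"
    (is "?dets \<longleftrightarrow> ?coeffs")
proof
  assume dets: ?dets
  then show ?coeffs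
    using hankel_det_2[OF g] stieltjes_coeff_hankel_det[OF g] nz
    by (simp add: eq_divide_eq)
next
  assume coeffs: ?coeffs
  have "hankel_det g m = E m" for m
  proof (induction m rule: less_induct)
    case (less m)
    have "m = 0 \<or> m = Suc 0 \<or> m = Suc (Suc 0) \<or> m = Suc (Suc (Suc (m - 3)))"
      by arith
    then consider "m = 0" | "m = Suc 0" | "m = Suc (Suc 0)" | k where "m = Suc (Suc (Suc k))"
      by blast
    then show ?case
    proof cases
      case (4 k)
      have "hankel_det g m * E k = c (Suc k) * (E (Suc (Suc k)) * E (Suc k))"
        using stieltjes_coeff_hankel_det[OF g, of k] less 4 by simp
      also have "\<dots> = E m * E k"
        using coeffs nz 4 by simp
      finally show ?thesis
        using nz by simp
    qed (use E0 coeffs hankel_det_start hankel_det_2[OF g] in simp_all)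
  qed
  then show ?dets ..
qed

section \<open>The theorem\<close>

theorem mainTheorem3:
  fixes H K :: "nat \<Rightarrow> 'a::field"
  assumes "H 0 = 1" and "K 0 = 1"
    and "\<forall>n\<ge>1. H n * K n \<noteq> 0"
  shows "(\<exists>!(c, g). nondegenerate c \<and> stieltjes_fraction c g \<and>
            (\<forall>n\<ge>1. det (hankel_mat 0 g n) = H n \<and> det (hankel_mat 1 g n) = K n)) \<and>
         (\<forall>c g. nondegenerate c \<and> stieltjes_fraction c g \<and>
            (\<forall>n\<ge>1. det (hankel_mat 0 g n) = H n \<and> det (hankel_mat 1 g n) = K n) \<longrightarrow>
            c 0 = H 1 \<and>
            (\<forall>n\<ge>1. c (2 * n - 1) = H (n - 1) * K n / (H n * K (n - 1)) \<and>
                   c (2 * n) = H (n + 1) * K (n - 1) / (H n * K n)))"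
proof -
  define E where "E m = (if even m then H (m div 2) else K (m div 2))" for m
  have HK: "H n \<noteq> 0 \<and> K n \<noteq> 0" for n
    using assms by (cases "n = 0") auto
  have E: "E 0 = 1" "E (Suc 0) = 1" and nz: "E m \<noteq> 0" for m
    using assms HK by (auto simp: E_def)
  have E_nth: "E (2 * n) = H n" "E (Suc (2 * n)) = K n" for n
    by (simp_all add: E_def)
  \<comment> \<open>the closed formulas for the coefficients, with odd and even indices treated at once\<close>
  define d where "d m = (case m of 0 \<Rightarrow> E (Suc (Suc 0))
      | Suc k \<Rightarrow> E (Suc (Suc (Suc k))) * E k / (E (Suc (Suc k)) * E (Suc k)))" for m
  have dets_iff: "(\<forall>n\<ge>1. det (hankel_mat 0 g n) = H n \<and> det (hankel_mat 1 g n) = K n)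
      \<longleftrightarrow> c = d" if g: "stieltjes_fraction c g" for c g
  proof -
    let ?P = "\<lambda>n. det (hankel_mat 0 g n) = H n \<and> det (hankel_mat 1 g n) = K n"
    have "?P 0"
      using assms(1,2) by simp
    then have "(\<forall>n\<ge>1. ?P n) \<longleftrightarrow> (\<forall>n. ?P n)"
      by (metis less_one not_less)
    also have "\<dots> \<longleftrightarrow> (\<forall>m. hankel_det g m = E m)"
    proof
      assume "\<forall>n. ?P n"
      then show "\<forall>m. hankel_det g m = E m"
        by (simp add: hankel_det_def E_def mod2_eq_if)
    next
      assume "\<forall>m. hankel_det g m = E m"
      then show "\<forall>n. ?P n"
        by (metis hankel_det_even hankel_det_odd E_nth)
    qed
    also have "\<dots> \<longleftrightarrow> c = d"
      unfolding hankel_det_eq_iff[OF g E nz] fun_eq_iff d_def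
      by (auto split: nat.splits)
    finally show ?thesis .
  qed
  have d_odd: "d (2 * n - 1) = H (n - 1) * K n / (H n * K (n - 1))"
    and d_even: "d (2 * n) = H (n + 1) * K (n - 1) / (H n * K n)" if "n \<ge> 1" for n
  proof -
    obtain l where l: "n = Suc l"
      using \<open>n \<ge> 1\<close> by (cases n) auto
    show "d (2 * n - 1) = H (n - 1) * K n / (H n * K (n - 1))"
      using E_nth[of l] E_nth[of "Suc l"] l
      by (simp add: d_def mult.commute)
    show "d (2 * n) = H (n + 1) * K (n - 1) / (H n * K n)"
      using E_nth[of l] E_nth[of "Suc l"] E_nth[of "Suc (Suc l)"] l
      by (simp add: d_def mult.commute)
  qed
  have d0: "d 0 = H 1"
    using E_nth(1)[of 1] by (simp add: d_def numeral_2_eq_2)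
  have nd: "nondegenerate d"
    unfolding nondegenerate_def d_def using nz by (auto split: nat.splits)
  obtain g where g: "stieltjes_fraction d g"
    using ex_stieltjes_fraction by blast
  have sol_iff: "nondegenerate c \<and> stieltjes_fraction c g' \<and>
      (\<forall>n\<ge>1. det (hankel_mat 0 g' n) = H n \<and> det (hankel_mat 1 g' n) = K n)
      \<longleftrightarrow> c = d \<and> g' = g" for c g'
    using dets_iff nd g stieltjes_fraction_unique by blast
  show ?thesis
    unfolding sol_iff using d0 d_odd d_even by auto
qed

end
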